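(* Let $k\ge2$ and $c\ge1$ be integers, with $c$ even if $k$ is even. Let $n=ck(k+1)$, $d=n/2$, and $\hat C=(J_{k+1}-I_{k+1})\otimes J_{ck}$. Then $$\mathrm{SDPOPT}_k(\hat C)\le\frac{\pi^2}{n}\cdot\frac{k}{k+1}\cdot\mathrm{CYCOPT}(\hat C).$$
   Context: $J_m,I_m$ are the $m\times m$ all-ones and identity matrices and $\otimes$ is the Kronecker product. For even $n$ divisible by $k$, $d=n/2$, and symmetric cost matrix $C\in\mathbb{R}^{n\times n}$, $\mathrm{SDPOPT}_k(C)$ is the optimal value of the SDP: minimize $\frac12\operatorname{tr}(CX^{(k)})$ over real symmetric $n\times n$ matrices $X^{(1)},\dots,X^{(d)}$ subject to $X^{(j)}\ge0$ entrywise ($j=1,\dots,d$); $\sum_{j=1}^dX^{(j)}=J_n-I_n$; and $I_n+\sum_{j=1}^d\cos(2\pi ij/n)X^{(j)}$ positive semidefinite for $i=1,\dots,d$. $\mathrm{CYCOPT}(C)$ is the minimum-cost $k$-cycle cover: the minimum of $\sum_{\{u,v\}\in F}C_{uv}$ over edge sets $F$ of $K_n$ forming $k$ vertex-disjoint cycles, each of length $n/k$, covering all $n$ vertices. *)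

theory Defs
  imports Complex_Main "HOL-Library.Extended_Real" "Jordan_Normal_Form.Matrix"
begin

definition ones_mat :: "nat \<Rightarrow> real mat" where
  "ones_mat m = mat m m (\<lambda>_. 1)"

definition kronecker_mat :: "real mat \<Rightarrow> real mat \<Rightarrow> real mat" where
  "kronecker_mat A B =
     mat (dim_row A * dim_row B) (dim_col A * dim_col B)
       (\<lambda>(u, v). A $$ (u div dim_row B, v div dim_col B) * B $$ (u mod dim_row B, v mod dim_col B))"

definition trace_mat :: "real mat \<Rightarrow> real" where
  "trace_mat A = (\<Sum>u<dim_row A. A $$ (u, u))"

definition sym_mat :: "nat \<Rightarrow> real mat \<Rightarrow> bool" where
  "sym_mat n A \<longleftrightarrow> A \<in> carrier_mat n n \<and> transpose_mat A = A"

definition psd_mat :: "nat \<Rightarrow> real mat \<Rightarrow> bool" where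
  "psd_mat n A \<longleftrightarrow> sym_mat n A \<and> (\<forall>x \<in> carrier_vec n. 0 \<le> x \<bullet> (A *\<^sub>v x))"

text \<open>The type of matrices is not an instance of \<^class>\<open>comm_monoid_add\<close>, so sums of \<open>n\<close>-by-\<open>n\<close>
  matrices are formed entrywise.\<close>

definition sum_mats :: "nat \<Rightarrow> (nat \<Rightarrow> real mat) \<Rightarrow> nat set \<Rightarrow> real mat" where
  "sum_mats n X S = mat n n (\<lambda>(u, v). \<Sum>j\<in>S. X j $$ (u, v))"

text \<open>Only the values of \<open>X\<close> on \<open>{1..d}\<close> with \<open>d = n div 2\<close> are relevant.\<close>

definition sdp_feasible :: "nat \<Rightarrow> (nat \<Rightarrow> real mat) \<Rightarrow> bool" where
  "sdp_feasible n X \<longleftrightarrow>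
     (let d = n div 2 in
       (\<forall>j \<in> {1..d}. sym_mat n (X j)) \<and>
       (\<forall>j \<in> {1..d}. \<forall>u < n. \<forall>v < n. 0 \<le> X j $$ (u, v)) \<and>
       sum_mats n X {1..d} = ones_mat n - 1\<^sub>m n \<and>
       (\<forall>i \<in> {1..d}.
          psd_mat n
            (1\<^sub>m n + sum_mats n (\<lambda>j. cos (2 * pi * real i * real j / real n) \<cdot>\<^sub>m X j) {1..d})))"

text \<open>The infimum is taken in the extended reals, so that an infeasible program has value \<open>\<infinity>\<close>.\<close>

definition sdp_opt :: "nat \<Rightarrow> nat \<Rightarrow> real mat \<Rightarrow> ereal" where
  "sdp_opt n k C = (INF X \<in> {X. sdp_feasible n X}. ereal (1 / 2 * trace_mat (C * X k)))"

text \<open>The vertices of \<open>K\<^sub>n\<close> are \<open>{..<n}\<close>, its edges the two-element sets of vertices.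
  A cycle is given by the list of its vertices in cyclic order.\<close>

definition is_cycle :: "nat list \<Rightarrow> bool" where
  "is_cycle vs \<longleftrightarrow> distinct vs \<and> 3 \<le> length vs"

definition cycle_edges :: "nat list \<Rightarrow> nat set set" where
  "cycle_edges vs = {{vs ! i, vs ! (Suc i mod length vs)} | i. i < length vs}"

definition cycle_covers :: "nat \<Rightarrow> nat \<Rightarrow> nat set set set" where
  "cycle_covers n k =
     {F. \<exists>cyc :: nat \<Rightarrow> nat list.
           (\<forall>j < k. is_cycle (cyc j) \<and> length (cyc j) = n div k) \<and>
           (\<forall>i < k. \<forall>j < k. i \<noteq> j \<longrightarrow> set (cyc i) \<inter> set (cyc j) = {}) \<and>
           (\<Union>j<k. set (cyc j)) = {..<n} \<and>
           F = (\<Union>j<k. cycle_edges (cyc j))}"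

text \<open>For a symmetric cost matrix the orientation chosen for reading off the cost of an edge is
  immaterial.\<close>

definition edge_cost :: "real mat \<Rightarrow> nat set \<Rightarrow> real" where
  "edge_cost C e = C $$ (Min e, Max e)"

definition cyc_opt :: "nat \<Rightarrow> nat \<Rightarrow> real mat \<Rightarrow> real" where
  "cyc_opt n k C = Min ((\<lambda>F. \<Sum>e\<in>F. edge_cost C e) ` cycle_covers n k)"

text \<open>The minimum in \<^const>\<open>cyc_opt\<close> ranges over a finite set, which is nonempty whenever cycles
  of length \<open>n div k\<close> exist.\<close>

lemma finite_cycle_covers: "finite (cycle_covers n k)"
proof (rule finite_subset)
  show "cycle_covers n k \<subseteq> Pow (Pow {..<n})"
  proof
    fix F assume "F \<in> cycle_covers n k"
    then obtain cyc :: "nat \<Rightarrow> nat list" where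
      un: "(\<Union>j<k. set (cyc j)) = {..<n}" and F: "F = (\<Union>j<k. cycle_edges (cyc j))"
      unfolding cycle_covers_def by blast
    have "e \<subseteq> {..<n}" if "j < k" "e \<in> cycle_edges (cyc j)" for j e
    proof -
      have "e \<subseteq> set (cyc j)"
        using that(2) by (auto simp: cycle_edges_def intro!: nth_mem mod_less_divisor)
      then show ?thesis using that(1) un by blast
    qed
    then show "F \<in> Pow (Pow {..<n})" using F by blast
  qed
qed simp

lemma cycle_covers_nonempty:
  assumes "k dvd n" "3 \<le> n div k"
  shows "cycle_covers n k \<noteq> {}"
proof -
  define l where "l = n div k"
  have n: "n = k * l" and l: "3 \<le> l" using assms by (auto simp: l_def)
  define cyc where "cyc j = [j * l..<j * l + l]" for j
  have div: "v div l = j" if "v \<in> set (cyc j)" for v j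
    using that by (auto simp: cyc_def intro!: div_nat_eqI simp: algebra_simps)
  have mem: "v \<in> set (cyc (v div l))" for v
    using l dividend_less_div_times[of l v] by (simp add: cyc_def add.commute)
  have "v < n \<longleftrightarrow> v div l < k" for v
    using l by (simp add: n div_less_iff_less_mult)
  then have un: "(\<Union>j<k. set (cyc j)) = {..<n}" using div mem by blast
  have dj: "\<forall>i<k. \<forall>j<k. i \<noteq> j \<longrightarrow> set (cyc i) \<inter> set (cyc j) = {}" using div by blast
  have "\<forall>j<k. is_cycle (cyc j) \<and> length (cyc j) = n div k"
    using l by (simp add: is_cycle_def cyc_def flip: l_def)
  with un dj have "(\<Union>j<k. cycle_edges (cyc j)) \<in> cycle_covers n k"
    unfolding cycle_covers_def by blast
  then show ?thesis by blast
qed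

end

theory Submission
  imports Defs "HOL-Analysis.Convex"
begin

text \<open>Write \<open>m = c * k\<close> for the block size. A cycle has \<open>c * (k + 1) > m\<close> vertices, so it leaves
  some block and crosses between blocks at least twice; hence every cycle cover costs at least
  \<open>2 * k\<close>.

  On the other side let \<open>X j\<close> have entry \<open>a j\<close> inside blocks and \<open>b j\<close> between blocks, with row sums
  those of a distance-\<open>j\<close> graph of an \<open>n\<close>-cycle. By these row sums the semidefinite constraints
  reduce to the cosine sums of \<open>b\<close> being nonpositive at all frequencies \<open>1, \<dots>, d\<close>, while \<open>a j \<ge> 0\<close>
  bounds \<open>b j\<close> by \<open>1 + 1 / k\<close> times the average. The choice of \<open>b\<close> that attains this bound off the
  multiples of \<open>k\<close> and is proportional to \<open>1 - cos (2 * pi * j / n)\<close> on them satisfies both, and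
  makes \<open>b k\<close> of order \<open>4 * pi\<^sup>2 * k / n\<^sup>3\<close>.\<close>

section \<open>Cosine sums over a full period and rearrangements of finite sums\<close>

lemma sum_cos_full_period:
  fixes i n :: nat
  assumes "n > 0"
  shows "(\<Sum>j<n. cos (2 * pi * real i * real j / real n)) = (if n dvd i then real n else 0)"
proof -
  \<comment> \<open>The sum is the real part of a geometric series in the \<open>n\<close>-th root
    of unity \<open>z\<close>, which vanishes unless \<open>z = 1\<close>.\<close>
  define z where "z = cis (2 * pi * real i / real n)"
  have pow: "z ^ j = cis (2 * pi * real i * real j / real n)" for j
    by (simp add: z_def DeMoivre mult_ac)
  have "(\<Sum>j<n. z ^ j) = (if n dvd i then of_nat n else 0)"
  proof (cases "n dvd i")
    case True
    then obtain q where q: "i = n * q" by blast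
    have "2 * pi * real i / real n = 2 * pi * real q" using assms by (simp add: q)
    then have "z = cis (2 * pi * real q)" by (simp only: z_def)
    also have "\<dots> = 1" by (rule cis_multiple_2pi) simp
    finally show ?thesis using True by simp
  next
    case False
    have "z \<noteq> 1"
    proof
      assume "z = 1"
      then have "cos (2 * pi * real i / real n) = 1"
        by (simp add: z_def complex_eq_iff)
      then obtain x :: int where "2 * pi * real i / real n = of_int x * 2 * pi"
        using cos_one_2pi_int by blast
      then have "real i = of_int x * real n"
        using assms by (simp add: field_simps)
      then have "int i = x * int n"
        by (metis of_int_eq_iff of_int_mult of_int_of_nat_eq)
      then show False using False by (metis dvd_triv_right int_dvd_int_iff)
    qed
    moreover have "z ^ n = 1"
      using assms cis_multiple_2pi[of "real i"] by (simp add: pow)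
    ultimately show ?thesis using False by (simp add: geometric_sum)
  qed
  then have "Re (\<Sum>j<n. z ^ j) = (if n dvd i then real n else 0)" by simp
  then show ?thesis by (simp add: pow)
qed

lemma one_minus_cos_le: "1 - cos x \<le> x\<^sup>2 / 2" for x :: real
proof -
  have "\<bar>sin (x / 2)\<bar>\<^sup>2 \<le> \<bar>x / 2\<bar>\<^sup>2"
    by (intro power_mono abs_sin_x_le_abs_x) simp
  then show ?thesis using cos_double_sin[of "x / 2"] by (simp add: power_divide)
qed

text \<open>Reflecting \<open>j\<close> to \<open>2 * d - j\<close> pairs the nonzero residues,
  except that \<open>d\<close> is its own mirror image and so gets weight 1. This converts sums over
  the distances \<open>1..d\<close> into sums over all nonzero residues.\<close>

lemma sum_fold_reflection:
  fixes h :: "nat \<Rightarrow> real"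
  assumes "d > 0" and sym: "\<And>j. 0 < j \<Longrightarrow> j < 2 * d \<Longrightarrow> h (2 * d - j) = h j"
  shows "(\<Sum>j=1..d. (if j = d then 1 else 2) * h j) = (\<Sum>j=1..<2 * d. h j)"
proof -
  have refl: "(\<Sum>j=d+1..<2 * d. h j) = (\<Sum>j=1..<d. h j)"
    by (rule sum.reindex_bij_witness[of _ "\<lambda>j. 2 * d - j" "\<lambda>j. 2 * d - j"]) (auto simp: sym)
  have "(\<Sum>j=1..<2 * d. h j) = (\<Sum>j=1..<d. h j) + (\<Sum>j=d..<2 * d. h j)"
    using assms(1) by (intro sum.atLeastLessThan_concat[symmetric]) auto
  also have "(\<Sum>j=d..<2 * d. h j) = h d + (\<Sum>j=d+1..<2 * d. h j)"
    using assms(1) by (simp add: sum.atLeast_Suc_lessThan)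
  finally have R: "(\<Sum>j=1..<2 * d. h j) = h d + 2 * (\<Sum>j=1..<d. h j)"
    using refl by simp
  have "{1..d} = insert d {1..<d}" using assms(1) by auto
  then have "(\<Sum>j=1..d. (if j = d then 1 else 2) * h j)
      = h d + (\<Sum>j=1..<d. (if j = d then 1 else 2) * h j)"
    by simp
  also have "(\<Sum>j=1..<d. (if j = d then 1 else 2) * h j) = (\<Sum>j=1..<d. 2 * h j)"
    by (rule sum.cong) auto
  finally show ?thesis using R by (simp add: sum_distrib_left)
qed

lemma sum_multiples:
  fixes h :: "nat \<Rightarrow> real"
  assumes "k > 0"
  shows "(\<Sum>j<k * l. if k dvd j then h j else 0) = (\<Sum>s<l. h (k * s))"
proof -
  have "(\<Sum>s<l. h (k * s)) = sum h ((\<lambda>s. k * s) ` {..<l})"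
    using assms by (subst sum.reindex) (auto simp: inj_on_def)
  also have "(\<lambda>s. k * s) ` {..<l} = {j \<in> {..<k * l}. k dvd j}"
    using assms by (auto simp: dvd_def)
  finally show ?thesis by (simp add: sum.inter_filter[symmetric])
qed

section \<open>Quadratic forms of two-level block matrices\<close>

lemma card_block:
  fixes m g p :: nat
  assumes "m > 0" "p < g"
  shows "card {u. u < g * m \<and> u div m = p} = m"
proof -
  have "u < g * m" if "u div m = p" for u
    using that assms by (metis div_less_iff_less_mult)
  then have "{u. u < g * m \<and> u div m = p} = {u. u div m = p}" by auto
  also have "\<dots> = {p * m..<p * m + m}"
  proof (rule Set.set_eqI, rule iffI)
    fix u assume "u \<in> {u. u div m = p}"
    then show "u \<in> {p * m..<p * m + m}"
      using assms dividend_less_div_times[of m u] by (auto simp: mult.commute)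
  qed (auto intro!: div_nat_eqI simp: algebra_simps)
  finally show ?thesis by simp
qed

text \<open>The three distinct eigenvalues of the two-level block matrix are \<open>1 - A\<close>,
  \<open>1 - A + m * (A - B)\<close> and the quantity in the last hypothesis.\<close>

lemma two_level_form_nonneg:
  fixes x :: "nat \<Rightarrow> real" and A B :: real and m g :: nat
  assumes m: "m > 0" and g: "g > 0" and A: "A \<le> 1" and B: "B \<le> 0"
    and E: "0 \<le> 1 + (real m - 1) * A + real m * (real g - 1) * B"
  shows "0 \<le> (\<Sum>u<g * m. \<Sum>v<g * m.
    x u * ((if u = v then 1 else if u div m = v div m then A else B) * x v))"
proof -
  define V where "V = {..<g * m}"
  define bl where "bl p = {u. u < g * m \<and> u div m = p}" for p
  define s where "s p = sum x (bl p)" for p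
  define Q where "Q = (\<Sum>u\<in>V. (x u)\<^sup>2)"
  define S where "S = (\<Sum>p<g. (s p)\<^sup>2)"
  have lt: "u div m < g" if "u < g * m" for u using that m by (simp add: div_less_iff_less_mult)
  have fin: "finite V" by (simp add: V_def)
  have blocks: "(\<Sum>p<g. sum F (bl p)) = sum F V" for F :: "nat \<Rightarrow> real"
    using sum.group[of V "{..<g}" "\<lambda>u. u div m" F] lt by (auto simp: bl_def V_def)
  have same: "(\<Sum>u\<in>V. \<Sum>v\<in>V. if u div m = v div m then x u * x v else 0) = S"
  proof -
    have "(\<Sum>v\<in>V. if u div m = v div m then x u * x v else 0) = x u * s (u div m)" for u
    proof -
      have "(\<Sum>v\<in>V. if u div m = v div m then x u * x v else 0)
          = (\<Sum>v\<in>V. if v div m = u div m then x u * x v else 0)"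
        by (intro sum.cong) auto
      also have "\<dots> = (\<Sum>v\<in>bl (u div m). x u * x v)"
        unfolding bl_def by (subst sum.inter_filter[symmetric]) (auto simp: V_def)
      finally show ?thesis by (simp add: s_def sum_distrib_left)
    qed
    then have "(\<Sum>u\<in>V. \<Sum>v\<in>V. if u div m = v div m then x u * x v else 0)
        = (\<Sum>u\<in>V. x u * s (u div m))" by simp
    also have "\<dots> = (\<Sum>p<g. \<Sum>u\<in>bl p. x u * s (u div m))" by (rule blocks[symmetric])
    also have "\<dots> = (\<Sum>p<g. \<Sum>u\<in>bl p. x u * s p)"
      by (intro sum.cong refl) (auto simp: bl_def)
    also have "\<dots> = S" by (simp add: S_def s_def sum_distrib_right power2_eq_square)
    finally show ?thesis .
  qed
  \<comment> \<open>The matrix is \<open>1 - A\<close> times the identity, plus \<open>A - B\<close>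
    times the block-diagonal all-ones matrix, plus \<open>B\<close> times the full all-ones
    matrix.\<close>
  have "(\<Sum>u\<in>V. \<Sum>v\<in>V. x u * ((if u = v then 1 else if u div m = v div m then A else B) * x v))
     = (\<Sum>u\<in>V. \<Sum>v\<in>V. (1 - A) * (if u = v then (x u)\<^sup>2 else 0)
          + (A - B) * (if u div m = v div m then x u * x v else 0) + B * (x u * x v))"
    by (intro sum.cong refl) (auto simp: algebra_simps power2_eq_square)
  also have "\<dots> = (1 - A) * Q + (A - B) * S + B * (sum x V)\<^sup>2"
    using fin by (simp add: sum.distrib same Q_def sum_distrib_left[symmetric] power2_eq_square sum_product)
  finally have form: "(\<Sum>u\<in>V. \<Sum>v\<in>V.
      x u * ((if u = v then 1 else if u div m = v div m then A else B) * x v))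
     = (1 - A) * Q + (A - B) * S + B * (sum x V)\<^sup>2" .
  \<comment> \<open>Cauchy-Schwarz inside each block gives \<open>S \<le> m * Q\<close>; applied to
    the block sums it bounds \<open>(sum x V)\<^sup>2\<close> by \<open>g * S\<close>, and
    multiplying by \<open>B \<le> 0\<close> reverses that inequality.\<close>
  have "S \<le> (\<Sum>p<g. (\<Sum>u\<in>bl p. (x u)\<^sup>2) * real m)"
    unfolding S_def
  proof (rule sum_mono)
    fix p assume "p \<in> {..<g}"
    then have "card (bl p) = m" using card_block[OF m] by (simp add: bl_def)
    then show "(s p)\<^sup>2 \<le> (\<Sum>u\<in>bl p. (x u)\<^sup>2) * real m"
      using sum_squared_le_sum_of_squares[of x "bl p"] by (simp add: s_def)
  qed
  also have "\<dots> = Q * real m" by (simp add: sum_distrib_right[symmetric] blocks Q_def)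
  finally have SQ: "S \<le> real m * Q" by (simp add: mult.commute)
  have "(sum x V)\<^sup>2 \<le> S * real g"
    using sum_squared_le_sum_of_squares[of s "{..<g}"] by (simp add: S_def s_def blocks)
  then have "B * (S * real g) \<le> B * (sum x V)\<^sup>2" using B by (rule mult_left_mono_neg)
  \<comment> \<open>After scaling the form by \<open>m\<close>, replacing \<open>m * Q\<close> by
    \<open>S\<close> and \<open>(sum x V)\<^sup>2\<close> by \<open>g * S\<close> leaves exactly
    \<open>S\<close> times the quantity in \<open>E\<close>.\<close>
  then have "real m * (B * (S * real g)) \<le> real m * (B * (sum x V)\<^sup>2)"
    by (rule mult_left_mono) simp
  moreover have "(1 - A) * S \<le> (1 - A) * (real m * Q)" using A SQ by (intro mult_left_mono) auto
  moreover have "0 \<le> S" by (simp add: S_def sum_nonneg)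
  then have "0 \<le> S * (1 + (real m - 1) * A + real m * (real g - 1) * B)"
    using E by (rule mult_nonneg_nonneg)
  ultimately have "0 \<le> real m * ((1 - A) * Q + (A - B) * S + B * (sum x V)\<^sup>2)"
    by (simp add: algebra_simps)
  then have "0 \<le> (1 - A) * Q + (A - B) * S + B * (sum x V)\<^sup>2"
    using m by (simp add: zero_le_mult_iff)
  then show ?thesis using form by (simp add: V_def)
qed

section \<open>Lower bound on the cost of a cycle cover\<close>

lemma exists_adjacent_differing:
  fixes c :: "nat \<Rightarrow> 'a"
  assumes "a \<le> b" "c a \<noteq> c b"
  shows "\<exists>i. a \<le> i \<and> i < b \<and> c i \<noteq> c (Suc i)"
  using assms
proof (induction rule: dec_induct)
  case (step b)
  show ?case
  proof (cases "c a = c b")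
    case True
    then show ?thesis using step by auto
  next
    case False
    then show ?thesis using step less_SucI by blast
  qed
qed simp

text \<open>Needed so that two colour changes along a cycle count as two edges. Length at least 3
  matters: around two vertices both steps would use the same edge.\<close>

lemma cycle_edge_inj:
  assumes "is_cycle vs"
  shows "inj_on (\<lambda>i. {vs ! i, vs ! (Suc i mod length vs)}) {..<length vs}"
proof (rule inj_onI)
  let ?l = "length vs"
  fix i j assume i: "i \<in> {..<?l}" and j: "j \<in> {..<?l}"
    and eq: "{vs ! i, vs ! (Suc i mod ?l)} = {vs ! j, vs ! (Suc j mod ?l)}"
  have d: "distinct vs" and l: "3 \<le> ?l" using assms by (auto simp: is_cycle_def)
  have lt: "Suc i mod ?l < ?l" "Suc j mod ?l < ?l" using l by (auto intro!: mod_less_divisor)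
  have "i = j \<or> (i = Suc j mod ?l \<and> Suc i mod ?l = j)"
    using eq i j lt d by (auto simp: doubleton_eq_iff nth_eq_iff_index_eq)
  moreover have False if "i = Suc j mod ?l" "Suc i mod ?l = j"
    using that i j l by (auto simp: mod_Suc split: if_splits)
  ultimately show "i = j" by blast
qed

text \<open>A closed walk that leaves a colour class must come back, so the colour changes at least
  twice.\<close>

lemma cycle_cost_ge_2:
  fixes colour :: "nat \<Rightarrow> 'a" and w :: "nat set \<Rightarrow> real"
  assumes cyc: "is_cycle vs"
    and nonneg: "\<And>e. e \<in> cycle_edges vs \<Longrightarrow> 0 \<le> w e"
    and cross: "\<And>u v. u \<in> set vs \<Longrightarrow> v \<in> set vs \<Longrightarrow> colour u \<noteq> colour v \<Longrightarrow> w {u, v} = 1"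
    and differ: "u \<in> set vs" "v \<in> set vs" "colour u \<noteq> colour v"
  shows "2 \<le> sum w (cycle_edges vs)"
proof -
  let ?l = "length vs"
  have l: "3 \<le> ?l" using cyc by (simp add: is_cycle_def)
  \<comment> \<open>Reduction modulo the length gives \<open>f ?l = f 0\<close>, which closes the
    walk.\<close>
  define f where "f i = colour (vs ! (i mod ?l))" for i
  define e where "e i = {vs ! i, vs ! (Suc i mod ?l)}" for i
  have edges: "cycle_edges vs = e ` {..<?l}" by (auto simp: cycle_edges_def e_def)
  obtain a b where "a < ?l" "b < ?l" "f a \<noteq> f b"
    using differ by (auto simp: in_set_conv_nth f_def)
  \<comment> \<open>One of \<open>a\<close>, \<open>b\<close> differs in colour from position 0. One
    change then occurs before \<open>q\<close>, and another from \<open>q\<close> on, where the walk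
    returns to its initial colour.\<close>
  then obtain q where q: "q < ?l" "f 0 \<noteq> f q" by metis
  obtain i where i: "i < q" "f i \<noteq> f (Suc i)"
    using exists_adjacent_differing[of 0 q f] q by auto
  have "f q \<noteq> f ?l" using q by (simp add: f_def)
  then obtain j where j: "q \<le> j" "j < ?l" "f j \<noteq> f (Suc j)"
    using exists_adjacent_differing[of q ?l f] q by auto
  have w1: "w (e t) = 1" if "t < ?l" "f t \<noteq> f (Suc t)" for t
  proof -
    have "Suc t mod ?l < ?l" using l by (intro mod_less_divisor) auto
    then show ?thesis using that unfolding e_def by (intro cross) (auto simp: f_def)
  qed
  have "e i \<noteq> e j"
    using inj_onD[OF cycle_edge_inj[OF cyc], of i j] i j q unfolding e_def by fastforce
  then have "sum w {e i, e j} = 2" using w1 i j q by simp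
  moreover have "sum w {e i, e j} \<le> sum w (cycle_edges vs)"
    using i j q nonneg by (intro sum_mono2) (auto simp: edges)
  ultimately show ?thesis by simp
qed

lemma kronecker_blocks_index:
  assumes "u < g * m" "v < g * m"
  shows "kronecker_mat (ones_mat g - 1\<^sub>m g) (ones_mat m) $$ (u, v)
    = (if u div m = v div m then 0 else 1)"
proof -
  have m: "m > 0" using assms by (cases m) auto
  have "u div m < g" "v div m < g" using assms m by (auto simp: div_less_iff_less_mult)
  then show ?thesis using assms m by (simp add: kronecker_mat_def ones_mat_def)
qed

lemma cyc_opt_blocks_ge:
  assumes k: "k > 0" "k dvd n" and l: "3 \<le> n div k" and m: "0 < m" "m < n div k" and n: "n = g * m"
  shows "2 * real k \<le> cyc_opt n k (kronecker_mat (ones_mat g - 1\<^sub>m g) (ones_mat m))"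
proof -
  define C where "C = kronecker_mat (ones_mat g - 1\<^sub>m g) (ones_mat m)"
  have cost: "edge_cost C {u, v} = (if u div m = v div m then 0 else 1)" if "u < n" "v < n" for u v
  proof -
    have C: "C $$ (u', v') = (if u' div m = v' div m then 0 else 1)" if "u' < n" "v' < n" for u' v'
      using that kronecker_blocks_index by (simp add: C_def n)
    show ?thesis using that by (cases u v rule: linorder_cases) (auto simp: edge_cost_def C min_def max_def)
  qed
  have "2 * real k \<le> (\<Sum>e\<in>F. edge_cost C e)" if F: "F \<in> cycle_covers n k" for F
  proof -
    obtain cyc where cyc: "\<And>j. j < k \<Longrightarrow> is_cycle (cyc j)"
      and len: "\<And>j. j < k \<Longrightarrow> length (cyc j) = n div k"
      and disj: "\<And>i j. i < k \<Longrightarrow> j < k \<Longrightarrow> i \<noteq> j \<Longrightarrow> set (cyc i) \<inter> set (cyc j) = {}"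
      and un: "(\<Union>j<k. set (cyc j)) = {..<n}" and F: "F = (\<Union>j<k. cycle_edges (cyc j))"
      using F unfolding cycle_covers_def by blast
    have V: "v < n" if "j < k" "v \<in> set (cyc j)" for j v using that un by blast
    have sub: "\<exists>u v. e = {u, v} \<and> u \<in> set (cyc j) \<and> v \<in> set (cyc j)"
      if "e \<in> cycle_edges (cyc j)" for e j
      using that by (fastforce simp: cycle_edges_def intro!: nth_mem mod_less_divisor)
    have two: "2 \<le> sum (edge_cost C) (cycle_edges (cyc j))" if j: "j < k" for j
    proof -
      obtain u where u: "u \<in> set (cyc j)" using len[OF j] l by (cases "cyc j") auto
      \<comment> \<open>A cycle inside one block would place \<open>n div k > m\<close> distinct
        vertices among only \<open>m\<close>.\<close>
      have "\<exists>v \<in> set (cyc j). u div m \<noteq> v div m"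
      proof (rule ccontr)
        assume "\<not> ?thesis"
        then have "set (cyc j) \<subseteq> {v. v < g * m \<and> v div m = u div m}" using V[OF j] n by auto
        then have "card (set (cyc j)) \<le> card {v. v < g * m \<and> v div m = u div m}"
          by (intro card_mono) auto
        moreover have "u div m < g" using V[OF j u] m by (simp add: n div_less_iff_less_mult)
        ultimately have "card (set (cyc j)) \<le> m" using card_block[of m "u div m" g] m by simp
        moreover have "card (set (cyc j)) = n div k"
          using cyc[OF j] len[OF j] by (simp add: is_cycle_def distinct_card)
        ultimately show False using m by simp
      qed
      then obtain v where v: "v \<in> set (cyc j)" "u div m \<noteq> v div m" by blast
      show ?thesis
      proof (rule cycle_cost_ge_2[OF cyc[OF j], where colour = "\<lambda>v. v div m"])
        fix e assume "e \<in> cycle_edges (cyc j)"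
        then show "0 \<le> edge_cost C e" using sub[of e j] V[OF j] by (auto simp: cost)
      qed (use u v V[OF j] in \<open>auto simp: cost\<close>)
    qed
    have "2 * real k = (\<Sum>j<k. 2)" by simp
    also have "\<dots> \<le> (\<Sum>j<k. sum (edge_cost C) (cycle_edges (cyc j)))"
      using two by (intro sum_mono) auto
    \<comment> \<open>Distinct cycles share no vertex, hence no edge, so their costs add up.\<close>
    also have "\<dots> = sum (edge_cost C) F"
      unfolding F
    proof (rule sum.UNION_disjoint[symmetric])
      show "\<forall>j\<in>{..<k}. finite (cycle_edges (cyc j))" by (auto simp: cycle_edges_def)
      show "\<forall>i\<in>{..<k}. \<forall>j\<in>{..<k}. i \<noteq> j \<longrightarrow> cycle_edges (cyc i) \<inter> cycle_edges (cyc j) = {}"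
      proof (intro ballI impI equals0I)
        fix i j e assume ij: "i \<in> {..<k}" "j \<in> {..<k}" "i \<noteq> j"
          and e: "e \<in> cycle_edges (cyc i) \<inter> cycle_edges (cyc j)"
        obtain u v u' v' where "e = {u, v}" "u \<in> set (cyc i)"
          and "e = {u', v'}" "u' \<in> set (cyc j)" "v' \<in> set (cyc j)"
          using sub[of e i] sub[of e j] e by blast
        then have "u \<in> set (cyc i) \<inter> set (cyc j)" by auto
        then show False using disj[of i j] ij by auto
      qed
    qed simp
    finally show ?thesis .
  qed
  then have "2 * real k \<le> cyc_opt n k C"
    using cycle_covers_nonempty[OF k(2) l] finite_cycle_covers[of n k]
    unfolding cyc_opt_def by (subst Min_ge_iff) auto
  then show ?thesis by (simp add: C_def)
qed

section \<open>Parameters and weights of the SDP solution\<close>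

locale block_solution =
  fixes k c :: nat
  assumes k: "k \<ge> 2" and c: "c \<ge> 1"
begin

text \<open>The block size of the cost matrix is \<open>m\<close>; the length of each cycle in a
  cover is \<open>l\<close>.\<close>

definition m :: nat where "m = c * k"
definition l :: nat where "l = c * (k + 1)"
definition n :: nat where "n = c * k * (k + 1)"
definition d :: nat where "d = n div 2"

lemma n_blocks: "n = (k + 1) * m" by (simp add: n_def m_def)
lemma n_cycles: "n = k * l" by (simp add: n_def l_def algebra_simps)
text \<open>One of the consecutive factors \<open>k\<close> and \<open>k + 1\<close> is
  even.\<close>

lemma n_even: "n = 2 * d" by (simp add: n_def d_def)
lemma m_ge: "m \<ge> 2" using mult_le_mono[OF c k] by (simp add: m_def)
lemma l_ge: "l \<ge> 3" using mult_le_mono[OF c, of 3 "k + 1"] k by (simp add: l_def)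
lemma n_pos: "n > 0" using m_ge by (simp add: n_blocks)
lemma d_pos: "d > 0" using n_pos n_even by simp

definition S :: "nat \<Rightarrow> nat \<Rightarrow> real" where
  "S N i = (\<Sum>j<N. cos (2 * pi * real i * real j / real N))"

lemma S_eq: "N > 0 \<Longrightarrow> S N i = (if N dvd i then real N else 0)"
  by (simp add: S_def sum_cos_full_period)

text \<open>As a function on the integers modulo \<open>n\<close>, \<open>f\<close> is \<open>1\<close> minus a convex combination of
  nonconstant cosines: weight \<open>1 / k\<close> on each nonzero multiple of \<open>l\<close>, and the remaining
  \<open>1 / k\<close> spread evenly over the frequencies congruent to \<open>1\<close> or \<open>-1\<close> modulo \<open>l\<close>. At \<open>j = k\<close>
  only the latter contribute.\<close>

definition f :: "nat \<Rightarrow> real" where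
  "f j = (if k dvd j then (1 - cos (2 * pi * real j / real n)) / real k else 1 + 1 / real k)"

text \<open>The factor \<open>w\<close> folds the residues \<open>j\<close> and \<open>n - j\<close> together; \<open>j = d\<close> is its own mirror image.
  The formula for \<open>a\<close> makes the rows of \<open>X j\<close> sum to \<open>n * w j\<close>.\<close>

definition w :: "nat \<Rightarrow> real" where "w j = (if j = d then 1 else 2) / real n"
definition b :: "nat \<Rightarrow> real" where "b j = w j * f j"
definition a :: "nat \<Rightarrow> real" where
  "a j = w j * ((real n - real m * real k * f j) / (real m - 1))"

section \<open>Reflection symmetry, cosine sums and sign conditions\<close>

lemma cos_reflect:
  assumes "j \<le> n"
  shows "cos (2 * pi * real i * real (n - j) / real n) = cos (2 * pi * real i * real j / real n)"
proof -
  have "2 * pi * real i * real (n - j) / real n = 2 * pi * real i - 2 * pi * real i * real j / real n"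
    using assms n_pos by (simp add: of_nat_diff field_simps)
  moreover have "cos (2 * pi * real i) = 1" "sin (2 * pi * real i) = 0"
    using cos_int_2pin[of "int i"] sin_int_2pin[of "int i"] by (auto simp: mult_ac)
  ultimately show ?thesis by (simp add: cos_diff)
qed

lemma f_reflect: "j \<le> n \<Longrightarrow> f (n - j) = f j"
  using cos_reflect[of j 1] dvd_diffD[of k n j] dvd_diff_nat[of k n j]
  by (auto simp: f_def n_cycles dest: dvd_diffD1)

lemma sum_w:
  assumes "\<And>j. j \<le> n \<Longrightarrow> h (n - j) = h j"
  shows "(\<Sum>j=1..d. w j * h j) = (\<Sum>j=1..<n. h j) / real n"
proof -
  have "(\<Sum>j=1..d. (if j = d then 1 else 2) * h j) = (\<Sum>j=1..<2 * d. h j)"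
    using d_pos assms by (intro sum_fold_reflection) (auto simp: n_even)
  then show ?thesis by (simp add: w_def n_even sum_divide_distrib[symmetric])
qed

lemma f_nonneg: "0 \<le> f j"
  using k by (auto simp: f_def)

text \<open>Since \<open>m * k * (1 + 1 / k) = n\<close>, this is the exact threshold up to which
  \<open>a j\<close> stays nonnegative.\<close>

lemma f_le: "f j \<le> 1 + 1 / real k"
proof -
  have "(1 - cos (2 * pi * real j / real n)) / real k \<le> 2 / real k"
    using cos_ge_minus_one[of "2 * pi * real j / real n"] k by (intro divide_right_mono) auto
  also have "\<dots> \<le> 1 + 1 / real k" using k by (simp add: field_simps)
  finally show ?thesis by (simp add: f_def)
qed

text \<open>Subtracting \<open>f\<close> from the constant \<open>1 + 1 / k\<close> leaves a
  correction supported on the multiples \<open>k * s\<close>, where \<open>k * s / n = s / l\<close>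
  reduces the period to \<open>l\<close>.\<close>

lemma sum_f_cos:
  "(\<Sum>j<n. f j * cos (2 * pi * real i * real j / real n))
    = (1 + 1 / real k) * S n i
      - (\<Sum>s<l. (1 + cos (2 * pi * real s / real l) / real k) * cos (2 * pi * real i * real s / real l))"
proof -
  define h where "h j = (1 + cos (2 * pi * real j / real n) / real k)
    * cos (2 * pi * real i * real j / real n)" for j
  have "f j * cos (2 * pi * real i * real j / real n)
     = (1 + 1 / real k) * cos (2 * pi * real i * real j / real n) - (if k dvd j then h j else 0)" for j
    using k by (simp add: f_def h_def field_simps)
  then have "(\<Sum>j<n. f j * cos (2 * pi * real i * real j / real n))
     = (1 + 1 / real k) * S n i - (\<Sum>j<n. if k dvd j then h j else 0)"
    by (simp add: sum_subtractf S_def sum_distrib_left)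
  also have "(\<Sum>j<n. if k dvd j then h j else 0) = (\<Sum>s<l. h (k * s))"
    using k by (subst n_cycles, subst sum_multiples) auto
  also have "(\<Sum>s<l. h (k * s)) = (\<Sum>s<l. (1 + cos (2 * pi * real s / real l) / real k)
      * cos (2 * pi * real i * real s / real l))"
  proof (rule sum.cong)
    fix s
    have "real (k * s) / real n = real s / real l" using k by (simp add: n_cycles)
    then have "2 * pi * x * real (k * s) / real n = 2 * pi * x * real s / real l" for x
      by (metis times_divide_eq_right)
    from this[of 1] this[of "real i"]
    show "h (k * s) = (1 + cos (2 * pi * real s / real l) / real k)
      * cos (2 * pi * real i * real s / real l)" by (simp add: h_def)
  qed simp
  finally show ?thesis .
qed

text \<open>For \<open>i\<close> in \<open>1..d\<close> these are the off-diagonal entries of the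
  \<open>i\<close>-th constraint matrix, \<open>A\<close> inside blocks and \<open>B\<close> between
  them; at \<open>i = 0\<close> they are the plain totals of \<open>a\<close> and
  \<open>b\<close>.\<close>

definition A :: "nat \<Rightarrow> real" where
  "A i = (\<Sum>j=1..d. a j * cos (2 * pi * real i * real j / real n))"
definition B :: "nat \<Rightarrow> real" where
  "B i = (\<Sum>j=1..d. b j * cos (2 * pi * real i * real j / real n))"

lemma sum_from_1: "(\<Sum>j=1..<n. h j) = (\<Sum>j<n. h j) - h 0" for h :: "nat \<Rightarrow> real"
  using n_pos by (simp add: lessThan_atLeast0 sum.atLeast_Suc_lessThan)

lemma B_eq: "B i = (\<Sum>j<n. f j * cos (2 * pi * real i * real j / real n)) / real n"
proof -
  have "B i = (\<Sum>j=1..d. w j * (f j * cos (2 * pi * real i * real j / real n)))"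
    by (simp add: B_def b_def mult.assoc)
  also have "\<dots> = (\<Sum>j=1..<n. f j * cos (2 * pi * real i * real j / real n)) / real n"
    by (rule sum_w) (simp only: cos_reflect f_reflect)
  \<comment> \<open>This value lets the missing term \<open>j = 0\<close> be included.\<close>
  also have "f 0 = 0" by (simp add: f_def)
  then have "(\<Sum>j=1..<n. f j * cos (2 * pi * real i * real j / real n))
      = (\<Sum>j<n. f j * cos (2 * pi * real i * real j / real n))"
    by (simp only: sum_from_1)
  finally show ?thesis .
qed

text \<open>The left side is the common row sum of the constraint matrix, its eigenvalue on the
  all-ones vector. By the choice of \<open>a\<close>, the function \<open>f\<close> cancels and only
  a full cosine sum remains.\<close>

lemma A_B: "1 + (real m - 1) * A i + real m * real k * B i = S n i"
proof -
  have "(real m - 1) * (a j * x) + real m * real k * (b j * x) = real n * (w j * x)" for j x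
  proof -
    have "(real m - 1) * a j + real m * real k * b j = real n * w j"
      using m_ge by (simp add: a_def b_def field_simps)
    then have "((real m - 1) * a j + real m * real k * b j) * x = real n * w j * x" by simp
    then show ?thesis by (simp only: distrib_right mult.assoc)
  qed
  then have "(real m - 1) * A i + real m * real k * B i
     = (\<Sum>j=1..d. real n * (w j * cos (2 * pi * real i * real j / real n)))"
    by (simp add: A_def B_def sum_distrib_left sum.distrib[symmetric])
  also have "\<dots> = real n * ((\<Sum>j=1..<n. cos (2 * pi * real i * real j / real n)) / real n)"
    by (subst sum_distrib_left[symmetric], subst sum_w) (simp_all only: cos_reflect)
  also have "\<dots> = S n i - 1"
    using n_pos by (simp only: sum_from_1 S_def) simp
  finally show ?thesis by simp
qed

lemma B_0: "B 0 = 1"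
proof -
  have "(\<Sum>s<l. (1 + cos (2 * pi * real s / real l) / real k) * cos (2 * pi * real 0 * real s / real l))
     = real l + S l 1 / real k"
    by (simp add: S_def sum.distrib sum_divide_distrib)
  also have "S l 1 = 0" using l_ge by (simp add: S_eq)
  finally have "real n * B 0 = (1 + 1 / real k) * real n - real l"
    using n_pos by (simp only: B_eq sum_f_cos) (simp add: S_eq)
  also have "\<dots> = real n" using k by (simp add: n_cycles field_simps)
  finally show ?thesis using n_pos by simp
qed

lemma A_0: "A 0 = 1"
proof -
  have "(real m - 1) * A 0 = real n - 1 - real m * real k"
    using A_B[of 0] n_pos by (simp add: B_0 S_eq)
  also have "\<dots> = (real m - 1) * 1" by (simp add: n_blocks algebra_simps)
  finally show ?thesis using m_ge by simp
qed

text \<open>Product-to-sum turns the correction in \<open>sum_f_cos\<close> into full cosine sums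
  modulo \<open>l\<close> at the frequencies \<open>i\<close>, \<open>i + 1\<close> and
  \<open>i - 1\<close>, all nonnegative, while \<open>S n i\<close> vanishes for
  \<open>0 < i < n\<close>.\<close>

lemma B_nonpos:
  assumes "1 \<le> i" "i < n"
  shows "B i \<le> 0"
proof -
  obtain i' where i': "i = Suc i'" using assms by (cases i) auto
  have "(1 + cos x / real k) * cos (real i * x)
      = cos (real i * x) + (cos (real (Suc i) * x) + cos (real i' * x)) / (2 * real k)" for x
  proof -
    have "cos x * cos (real i * x) = (cos (real (Suc i) * x) + cos (real i' * x)) / 2"
      using cos_times_cos[of "real i * x" x] by (simp add: i' algebra_simps)
    then show ?thesis using k by (simp add: field_simps)
  qed
  from this[of "2 * pi * real s / real l" for s]
  have "(\<Sum>s<l. (1 + cos (2 * pi * real s / real l) / real k) * cos (2 * pi * real i * real s / real l))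
     = S l i + (S l (Suc i) + S l i') / (2 * real k)"
    by (simp add: S_def sum.distrib sum_divide_distrib mult_ac add_divide_distrib del: of_nat_Suc)
  moreover have "0 \<le> S l j" for j using l_ge by (simp add: S_eq)
  then have "0 \<le> S l i + (S l (Suc i) + S l i') / (2 * real k)" by simp
  moreover have "S n i = 0" using assms n_pos by (auto simp: S_eq dest: dvd_imp_le)
  ultimately show ?thesis
    by (simp only: B_eq sum_f_cos) (intro divide_nonpos_nonneg; simp)
qed

lemma w_nonneg: "0 \<le> w j" by (simp add: w_def)
lemma b_nonneg: "0 \<le> b j" by (simp add: b_def w_nonneg f_nonneg)

lemma a_nonneg: "0 \<le> a j"
proof -
  have "real m * real k * f j \<le> real m * real k * (1 + 1 / real k)"
    using f_le by (intro mult_left_mono) auto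
  also have "\<dots> = real n" using k by (simp add: n_blocks field_simps)
  finally show ?thesis using m_ge by (simp add: a_def w_nonneg)
qed

lemma A_le: "A i \<le> 1"
proof -
  have "A i \<le> (\<Sum>j=1..d. a j * 1)"
    unfolding A_def using a_nonneg by (intro sum_mono mult_left_mono) auto
  also have "\<dots> = A 0" by (simp add: A_def)
  finally show ?thesis by (simp add: A_0)
qed

section \<open>Feasibility and objective value\<close>

definition X :: "nat \<Rightarrow> real mat" where
  "X j = mat n n (\<lambda>(u, v). if u = v then 0 else if u div m = v div m then a j else b j)"

lemma psd_mat_two_level:
  assumes "A' \<le> 1" "B' \<le> 0" "0 \<le> 1 + (real m - 1) * A' + real m * real k * B'"
  shows "psd_mat n (mat n n (\<lambda>(u, v). if u = v then 1 else if u div m = v div m then A' else B'))"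
    (is "psd_mat n ?M")
proof -
  have "transpose_mat ?M = ?M" by (rule eq_matI) auto
  moreover have "0 \<le> scalar_prod x (?M *\<^sub>v x)" if x: "x \<in> carrier_vec n" for x
  proof -
    have "scalar_prod x (?M *\<^sub>v x) = (\<Sum>u<n. \<Sum>v<n.
      vec_index x u * ((if u = v then 1 else if u div m = v div m then A' else B') * vec_index x v))"
      using x by (auto simp: scalar_prod_def lessThan_atLeast0 sum_distrib_left intro!: sum.cong)
    then show ?thesis
      using two_level_form_nonneg[of m "k + 1" A' B' "vec_index x"] assms m_ge by (simp add: n_blocks)
  qed
  ultimately show ?thesis by (simp add: psd_mat_def sym_mat_def)
qed

lemma feasible: "sdp_feasible n X"
proof -
  have "sym_mat n (X j)" for j
    unfolding sym_mat_def X_def by (auto intro!: eq_matI)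
  moreover have "0 \<le> X j $$ (u, v)" if "u < n" "v < n" for j u v
    using that by (simp add: X_def a_nonneg b_nonneg)
  moreover have "sum_mats n X {1..d} = ones_mat n - 1\<^sub>m n"
  proof -
    have "(\<Sum>j=1..d. a j) = 1" "(\<Sum>j=1..d. b j) = 1" using A_0 B_0 by (auto simp: A_def B_def)
    then have "(\<Sum>j=1..d. if Q then a j else b j) = 1" for Q by (cases Q) simp_all
    then show ?thesis by (intro eq_matI) (auto simp: sum_mats_def ones_mat_def X_def)
  qed
  moreover have "psd_mat n
      (1\<^sub>m n + sum_mats n (\<lambda>j. cos (2 * pi * real i * real j / real n) \<cdot>\<^sub>m X j) {1..d})"
    if i: "i \<in> {1..d}" for i
  proof -
    have "1\<^sub>m n + sum_mats n (\<lambda>j. cos (2 * pi * real i * real j / real n) \<cdot>\<^sub>m X j) {1..d}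
       = mat n n (\<lambda>(u, v). if u = v then 1 else if u div m = v div m then A i else B i)"
      by (rule eq_matI) (auto simp: sum_mats_def X_def A_def B_def mult.commute intro!: sum.cong)
    moreover have "i < n" using i n_even by auto
    then have "B i \<le> 0" using i by (intro B_nonpos) auto
    \<comment> \<open>By \<open>A_B\<close> this is the row-sum eigenvalue, the last hypothesis of
      \<open>psd_mat_two_level\<close>.\<close>
    moreover have "0 \<le> S n i" using n_pos by (simp add: S_eq)
    ultimately show ?thesis using A_le[of i] A_B[of i] by (simp add: psd_mat_two_level)
  qed
  ultimately show ?thesis by (auto simp: sdp_feasible_def Let_def simp flip: d_def)
qed

text \<open>Each of the \<open>n\<close> vertices has \<open>n - m = m * k\<close> vertices outside
  its block; only these pairs have nonzero cost, and each contributes \<open>b j\<close>.\<close>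

lemma objective:
  "trace_mat (kronecker_mat (ones_mat (k + 1) - 1\<^sub>m (k + 1)) (ones_mat m) * X j)
    = real n * (real m * real k) * b j"
proof -
  let ?C = "kronecker_mat (ones_mat (k + 1) - 1\<^sub>m (k + 1)) (ones_mat m)"
  have dim: "dim_row ?C = n" "dim_col ?C = n" "dim_row (X j) = n" "dim_col (X j) = n"
    by (auto simp: kronecker_mat_def ones_mat_def n_blocks X_def)
  have "trace_mat (?C * X j) = (\<Sum>u<n. \<Sum>v<n. ?C $$ (u, v) * X j $$ (v, u))"
    using dim by (auto simp: trace_mat_def scalar_prod_def lessThan_atLeast0 intro!: sum.cong)
  also have "\<dots> = (\<Sum>u<n. \<Sum>v<n. b j - (if v div m = u div m then b j else 0))"
    by (intro sum.cong refl) (auto simp: kronecker_blocks_index X_def n_blocks)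
  also have "\<dots> = (\<Sum>u<n. real n * b j - real m * b j)"
  proof (intro sum.cong refl)
    fix u assume "u \<in> {..<n}"
    then have "u div m < k + 1" using m_ge by (simp add: n_blocks div_less_iff_less_mult)
    then have "card {v. v < n \<and> v div m = u div m} = m"
      unfolding n_blocks using m_ge by (intro card_block) auto
    moreover have "(\<Sum>v<n. if v div m = u div m then b j else 0)
        = (\<Sum>v\<in>{v\<in>{..<n}. v div m = u div m}. b j)"
      by (rule sum.inter_filter[symmetric]) simp
    ultimately show "(\<Sum>v<n. b j - (if v div m = u div m then b j else 0)) = real n * b j - real m * b j"
      by (simp add: sum_subtractf)
  qed
  also have "\<dots> = real n * (real m * real k) * b j" by (simp add: n_blocks algebra_simps)
  finally show ?thesis .
qed

lemma b_k_le: "b k \<le> 4 * pi\<^sup>2 * real k / real n ^ 3"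
proof -
  \<comment> \<open>So \<open>k\<close> is not the self-paired index \<open>d\<close>, and
    \<open>w k\<close> equals \<open>2 / n\<close>.\<close>
  have "n \<noteq> 2 * k" using l_ge k by (simp add: n_cycles)
  then have "b k = 2 / (real n * real k) * (1 - cos (2 * pi * real k / real n))"
    by (auto simp: b_def w_def f_def n_even)
  also have "\<dots> \<le> 2 / (real n * real k) * ((2 * pi * real k / real n)\<^sup>2 / 2)"
    by (intro mult_left_mono one_minus_cos_le) simp
  also have "\<dots> = 4 * pi\<^sup>2 * real k / real n ^ 3"
    using k by (simp add: power2_eq_square power3_eq_cube field_simps)
  finally show ?thesis .
qed

end

section \<open>Comparison of the SDP value with the cycle cover bound\<close>

theorem theorem2:
  fixes k c n :: nat and Chat :: "real mat"
  assumes "k \<ge> 2" and "c \<ge> 1" and "even k \<Longrightarrow> even c"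
    and "n = c * k * (k + 1)"
    and "Chat = kronecker_mat (ones_mat (k + 1) - 1\<^sub>m (k + 1)) (ones_mat (c * k))"
  shows "sdp_opt n k Chat
           \<le> ereal (pi\<^sup>2 / real n * (real k / (real k + 1)) * cyc_opt n k Chat)"
proof -
  interpret sol: block_solution k c using assms(1,2) by unfold_locales
  have n: "n = sol.n" and C: "Chat = kronecker_mat (ones_mat (k + 1) - 1\<^sub>m (k + 1)) (ones_mat sol.m)"
    using assms(4,5) by (auto simp: sol.n_def sol.m_def)
  have len: "n div k = sol.l" using assms(1) by (simp add: n sol.n_cycles)
  have cyc: "2 * real k \<le> cyc_opt n k Chat"
    unfolding C
  proof (rule cyc_opt_blocks_ge)
    show "sol.m < n div k" using assms(2) by (simp add: len sol.m_def sol.l_def)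
    show "k dvd n" by (simp add: n sol.n_cycles)
    show "3 \<le> n div k" using sol.l_ge by (simp add: len)
    show "0 < sol.m" using sol.m_ge by simp
  qed (use assms(1) in \<open>auto simp: n sol.n_blocks\<close>)
  have pos: "real n > 0" using sol.n_pos n by simp
  have "sdp_opt n k Chat \<le> ereal (1 / 2 * trace_mat (Chat * sol.X k))"
    unfolding sdp_opt_def using sol.feasible n by (intro INF_lower) simp
  also have "1 / 2 * trace_mat (Chat * sol.X k) = 1 / 2 * (real n * (real sol.m * real k)) * sol.b k"
    by (simp only: C sol.objective n)
  also have "ereal \<dots> \<le> ereal (1 / 2 * (real n * (real sol.m * real k)) * (4 * pi\<^sup>2 * real k / real n ^ 3))"
    unfolding ereal_less_eq(3) using sol.b_k_le n by (intro mult_left_mono) auto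
  \<comment> \<open>The ratio \<open>m / n = 1 / (k + 1)\<close> yields the claimed factor; the
    \<open>2 * k\<close> split off is the lower bound on \<open>cyc_opt\<close>.\<close>
  also have "1 / 2 * (real n * (real sol.m * real k)) * (4 * pi\<^sup>2 * real k / real n ^ 3)
      = pi\<^sup>2 / real n * (real k / (real k + 1)) * (2 * real k)"
  proof -
    have "real n = (real k + 1) * real sol.m" by (simp add: n sol.n_blocks algebra_simps)
    then have "real sol.m / real n = 1 / (real k + 1)" using sol.m_ge by simp
    moreover have "1 / 2 * (real n * (real sol.m * real k)) * (4 * pi\<^sup>2 * real k / real n ^ 3)
        = pi\<^sup>2 / real n * (real k * (real sol.m / real n)) * (2 * real k)"
      using pos by (simp add: power3_eq_cube)
    ultimately show ?thesis by simp
  qed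
  also have "ereal \<dots> \<le> ereal (pi\<^sup>2 / real n * (real k / (real k + 1)) * cyc_opt n k Chat)"
    unfolding ereal_less_eq(3) using cyc by (intro mult_left_mono) auto
  finally show ?thesis .
qed

end
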